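(* Let $q$ be a complex number with $|q|<1$, and for integers $m\ge0$ let $$U_m(x)=\sum_{k=0}^m\begin{bmatrix}m+k\\k\end{bmatrix}_q\frac{x^k}{(-q;q)_k}.$$ Then for every integer $m\ge 0$ and every $x$, $$U_{m}(xq^2)=(1-x)U_m(x)+xq^{m+1}U_m(xq)+x^{m+1}\frac{(q;q^2)_{m+1}}{(q;q)_m}.$$
   Context: For integers $n\ge 0$, $(x;p)_n=\prod_{i=0}^{n-1}(1-xp^i)$ (empty product equal to $1$). The $q$-binomial coefficient is $\begin{bmatrix}n\\k\end{bmatrix}_q=\frac{(q;q)_n}{(q;q)_{n-k}(q;q)_k}$. *)

theory Defs
  imports Complex_Main
begin

definition qpoch :: "complex \<Rightarrow> complex \<Rightarrow> nat \<Rightarrow> complex" where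
  "qpoch x p n = (\<Prod>i<n. 1 - x * p ^ i)"

(* Meaningful for k \<le> n only, since n - k is truncated subtraction. *)
definition qbinom :: "complex \<Rightarrow> nat \<Rightarrow> nat \<Rightarrow> complex" where
  "qbinom q n k = qpoch q q n / (qpoch q q (n - k) * qpoch q q k)"

(* For norm q < 1 none of the denominators vanishes. *)
definition U :: "complex \<Rightarrow> nat \<Rightarrow> complex \<Rightarrow> complex" where
  "U q m x = (\<Sum>k\<le>m. qbinom q (m + k) k * (x ^ k / qpoch (- q) q k))"

end

theory Submission
  imports Defs
begin

text \<open>
  Comparing coefficients of powers of \<open>x\<close>: the coefficients \<open>c k\<close> of \<open>U q m\<close> satisfy
  \<open>c (k + 1) (1 - q^(2k+2)) = c k (1 - q^(m+k+1))\<close>, so the identity telescopes. Only the boundary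
  term at \<open>k = m\<close> survives, and it is evaluated by splitting \<open>(q;q)_(2m+1)\<close> into its odd part
  \<open>(q;q^2)_(m+1)\<close> and its even part \<open>(q^2;q^2)_m = (q;q)_m (-q;q)_m\<close>.
\<close>

lemma qpoch_Suc: "qpoch x p (Suc n) = qpoch x p n * (1 - x * p ^ n)"
  by (simp add: qpoch_def)

text \<open>Each \<open>x * p ^ i\<close> has norm at most \<open>norm x < 1\<close>, so no factor
  vanishes.\<close>

lemma qpoch_nonzero:
  assumes "norm x < 1" "norm p \<le> 1"
  shows "qpoch x p n \<noteq> 0"
proof -
  have "x * p ^ i \<noteq> 1" for i
  proof
    assume "x * p ^ i = 1"
    then have "norm x * norm p ^ i = 1"
      by (metis norm_mult norm_one norm_power)
    moreover have "norm x * norm p ^ i \<le> norm x * 1"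
      using assms by (intro mult_left_mono power_le_one) auto
    ultimately show False
      using assms by simp
  qed
  then show ?thesis
    by (auto simp: qpoch_def)
qed

text \<open>Each induction step adds two factors: \<open>1 - q ^ (2 * m + 2)\<close>, a difference
  of squares feeding the last two products, and \<open>1 - q ^ (2 * m + 3)\<close>, the next factor
  of the first.\<close>

lemma qpoch_odd_even_split:
  "qpoch q q (Suc (2 * m)) = qpoch q (q ^ 2) (Suc m) * qpoch q q m * qpoch (- q) q m"
proof (induction m)
  case 0
  show ?case by (simp add: qpoch_def)
next
  case (Suc m)
  have "qpoch q q (Suc (2 * Suc m))
      = qpoch q q (Suc (2 * m)) * (1 - q * q ^ Suc (2 * m)) * (1 - q * q ^ Suc (Suc (2 * m)))"
    by (simp add: qpoch_Suc)
  also have "1 - q * q ^ Suc (2 * m) = (1 - q * q ^ m) * (1 - (- q) * q ^ m)"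
    by (simp add: algebra_simps mult_2 mult_2_right power_add)
  also have "1 - q * q ^ Suc (Suc (2 * m)) = 1 - q * (q ^ 2) ^ Suc m"
    by (simp add: power_mult power2_eq_square)
  finally show ?case
    unfolding Suc.IH qpoch_Suc[of q "q ^ 2" "Suc m"] qpoch_Suc[of q q m] qpoch_Suc[of "- q" q m]
    by (simp only: mult_ac)
qed

theorem theorem3p3:
  fixes q x :: complex and m :: nat
  assumes "norm q < 1"
  shows "U q m (x * q ^ 2) =
    (1 - x) * U q m x + x * q ^ (m + 1) * U q m (x * q)
      + x ^ (m + 1) * (qpoch q (q ^ 2) (m + 1) / qpoch q q m)"
proof -
  define c where "c k = qbinom q (m + k) k / qpoch (- q) q k" for k
  \<comment> \<open>\<open>d k\<close> is the \<open>k\<close>-th term of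
    \<open>U q m x - U q m (x * q ^ 2)\<close>; by the recurrence for \<open>c\<close>,
    \<open>d (Suc k)\<close> is that of
    \<open>x * U q m x - x * q ^ (m + 1) * U q m (x * q)\<close>.\<close>
  define d where "d k = c k * (1 - q ^ (2 * k)) * x ^ k" for k
  have nz: "qpoch q q n \<noteq> 0" "qpoch (- q) q n \<noteq> 0" for n
    using assms by (simp_all add: qpoch_nonzero)
  have U_eq: "U q m y = (\<Sum>k\<le>m. c k * y ^ k)" for y
    by (simp add: U_def c_def)
  have c_rec: "c (Suc k) * (1 - q ^ (2 * Suc k)) = c k * (1 - q ^ (m + k + 1))" for k
  proof -
    have "1 - q ^ (2 * Suc k) = (1 - q * q ^ k) * (1 - (- q) * q ^ k)"
      by (simp add: algebra_simps mult_2 mult_2_right power_add)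
    \<comment> \<open>These are the last factors of nonzero products of length
      \<open>Suc k\<close>.\<close>
    moreover have "1 - q * q ^ k \<noteq> 0" "1 - (- q) * q ^ k \<noteq> 0"
      using nz[of "Suc k"] by (auto simp: qpoch_Suc)
    ultimately show ?thesis
      using nz by (simp add: c_def qbinom_def qpoch_Suc divide_simps)
  qed
  have d_Suc: "d (Suc k) = c k * (1 - q ^ (m + k + 1)) * x ^ Suc k" for k
    by (simp only: d_def c_rec)
  have "d (Suc m) = x ^ (m + 1) * (qpoch q (q ^ 2) (m + 1) / qpoch q q m)"
  proof -
    \<comment> \<open>The extra factor completes \<open>qpoch q q (2 * m)\<close> to odd length, so
      the odd-even split applies.\<close>
    have "c m * (1 - q ^ (m + m + 1))
        = qpoch q q (Suc (2 * m)) / (qpoch q q m * qpoch q q m * qpoch (- q) q m)"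
      by (simp add: c_def qbinom_def qpoch_Suc mult_2)
    also have "\<dots> = qpoch q (q ^ 2) (m + 1) / qpoch q q m"
      using nz by (simp add: qpoch_odd_even_split)
    finally show ?thesis
      unfolding d_Suc by simp
  qed
  \<comment> \<open>The factor \<open>1 - q ^ (2 * k)\<close> vanishes at \<open>k = 0\<close>, so
    there is no lower boundary term.\<close>
  moreover have "d 0 = 0"
    by (simp add: d_def)
  moreover then have "(\<Sum>k\<le>m. d (Suc k)) - (\<Sum>k\<le>m. d k) = d (Suc m)"
    using sum_telescope[of d m] unfolding sum_subtractf by (simp add: algebra_simps)
  moreover have "(\<Sum>k\<le>m. d k) = U q m x - U q m (x * q ^ 2)"
    unfolding U_eq d_def sum_subtractf[symmetric]
    by (rule sum.cong) (simp_all add: algebra_simps power_mult_distrib flip: power_mult)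
  moreover have "(\<Sum>k\<le>m. d (Suc k)) = x * U q m x - x * q ^ (m + 1) * U q m (x * q)"
    unfolding U_eq d_Suc sum_distrib_left sum_subtractf[symmetric]
    by (rule sum.cong) (simp_all add: algebra_simps power_mult_distrib power_add)
  ultimately show ?thesis
    by (simp add: algebra_simps)
qed

end
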